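(* Let $0<\epsilon$ and $\epsilon \le \phi \le 1$. In the distributed streaming model with $k\ge 2$ sites and one coordinator, there is a deterministic algorithm that continuously tracks the $\epsilon$-approximate $\phi$-heavy hitters of $A(t)$ at all times $t$, and whose total communication cost over the whole sequence of $n$ items is $O\!\left(\frac{k}{\epsilon}\log n\right)$.
   Context: Distributed streaming model: a sequence $A=(a_1,\dots,a_n)$ of items from the universe $U=\{1,\dots,u\}$ arrives over time; item $a_i$ arrives at time $t_i$ ($t_1<\dots<t_n$) at exactly one of $k$ sites $S_1,\dots,S_k$. Each site has a two-way communication channel with a designated coordinator $C$ (no direct site-to-site communication). A site may initiate communication only upon the arrival of an item at it; this may trigger further communication between the coordinator and sites; communication is instantaneous. $A(t)$ denotes the multiset of items arrived (at all sites) up to time $t$. Communication cost is measured in words of $\Theta(\log u)=\Theta(\log n)$ bits, and $n$ is assumed sufficiently large compared with $k$ and $1/\epsilon$. For $x\in U$, $m_x(A)$ is the number of occurrences of $x$ in $A$. The $\phi$-heavy hitters are $\{x : m_x(A)\ge \phi|A|\}$. An $\epsilon$-approximate answer is a set that contains all $x$ with $m_x(A)\ge\phi|A|$ and contains no $x$ with $m_x(A)<(\phi-\epsilon)|A|$. Tracking means that the coordinator holds such an answer for $A(t)$ at every time $t$. *)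

theory Defs
  imports Complex_Main "HOL-Library.Multiset" "HOL-Library.While_Combinator"
begin

text \<open>
  Sites are numbered \<open>1, \<dots>, k\<close> and the universe is \<open>{1..u}\<close>.  Messages are bit strings on the
  private channel between one site and the coordinator, so a packet is labelled with that site.
\<close>

type_synonym message = "bool list"

datatype packet = To_Coord (site: nat) (payload: message) | To_Site (site: nat) (payload: message)

text \<open>
  A deterministic protocol.  A site acts only when an item or a message from the coordinator
  reaches it, the coordinator only when a message from a site reaches it; so all communication is
  triggered by the arrival of an item.  Clocks are not available.  Computation is not restricted,
  and taking \<open>'s = 'c = nat\<close> is no restriction either: the reachable memory contents are determined
  by finite local histories, which can be coded as natural numbers.
\<close>

record ('s, 'c) protocol =
  site_init :: "nat \<Rightarrow> 's"
  coord_init :: 'c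
  site_item :: "nat \<Rightarrow> nat \<Rightarrow> 's \<Rightarrow> 's \<times> message list"
  site_recv :: "nat \<Rightarrow> message \<Rightarrow> 's \<Rightarrow> 's \<times> message list"
  coord_recv :: "nat \<Rightarrow> message \<Rightarrow> 'c \<Rightarrow> 'c \<times> (nat \<times> message) list"
  answer :: "'c \<Rightarrow> nat set"

definition protocol_for :: "nat \<Rightarrow> ('s, 'c) protocol \<Rightarrow> bool" where
  "protocol_for k P \<longleftrightarrow> (\<forall>j m \<gamma>. \<forall>(i, m') \<in> set (snd (coord_recv P j m \<gamma>)). i \<in> {1..k})"

type_synonym ('s, 'c) config = "(nat \<Rightarrow> 's) \<times> 'c"

fun deliver :: "('s, 'c) protocol \<Rightarrow> packet \<Rightarrow> ('s, 'c) config \<Rightarrow> ('s, 'c) config \<times> packet list" where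
  "deliver P (To_Coord j m) (\<sigma>, \<gamma>) =
     (let (\<gamma>', out) = coord_recv P j m \<gamma>
      in ((\<sigma>, \<gamma>'), map (\<lambda>(i, m'). To_Site i m') out))"
| "deliver P (To_Site i m) (\<sigma>, \<gamma>) =
     (let (s', out) = site_recv P i m (\<sigma> i)
      in ((\<sigma>(i := s'), \<gamma>), map (To_Coord i) out))"

text \<open>
  Communication is instantaneous: packets are delivered in the order in which they are sent, and
  the exchange runs until no packet is in transit, before the next item arrives.  The result is
  \<open>None\<close> if the exchange never ends.  The last component of the state is the transcript of all
  packets delivered.
\<close>

definition exchange ::
  "('s, 'c) protocol \<Rightarrow> ('s, 'c) config \<Rightarrow> packet list
     \<Rightarrow> (('s, 'c) config \<times> packet list \<times> packet list) option" where
  "exchange P cfg q =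
     while_option (\<lambda>(cfg, q, tr). q \<noteq> [])
       (\<lambda>(cfg, q, tr). let (cfg', out) = deliver P (hd q) cfg in (cfg', tl q @ out, tr @ [hd q]))
       (cfg, q, [])"

text \<open>An arrival \<open>(t, j, x)\<close> is the arrival of item \<open>x\<close> at site \<open>j\<close> at time \<open>t\<close>.\<close>

type_synonym arrival = "real \<times> nat \<times> nat"

fun arrive ::
  "('s, 'c) protocol \<Rightarrow> arrival \<Rightarrow> ('s, 'c) config \<times> packet list
     \<Rightarrow> (('s, 'c) config \<times> packet list) option" where
  "arrive P (t, j, x) ((\<sigma>, \<gamma>), tr) =
     (let (s', out) = site_item P j x (\<sigma> j)
      in map_option (\<lambda>(cfg', _, tr'). (cfg', tr @ tr'))
           (exchange P (\<sigma>(j := s'), \<gamma>) (map (To_Coord j) out)))"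

definition execute ::
  "('s, 'c) protocol \<Rightarrow> arrival list \<Rightarrow> (('s, 'c) config \<times> packet list) option" where
  "execute P A =
     foldl (\<lambda>r a. Option.bind r (arrive P a)) (Some ((site_init P, coord_init P), [])) A"

definition stream :: "nat \<Rightarrow> nat \<Rightarrow> arrival list \<Rightarrow> bool" where
  "stream k u A \<longleftrightarrow>
     sorted_wrt (<) (map fst A) \<and> (\<forall>(t, j, x) \<in> set A. j \<in> {1..k} \<and> x \<in> {1..u})"

definition arrived :: "real \<Rightarrow> arrival list \<Rightarrow> arrival list" where
  "arrived t A = filter (\<lambda>a. fst a \<le> t) A"

definition items :: "arrival list \<Rightarrow> nat multiset" where
  "items A = mset (map (\<lambda>(t, j, x). x) A)"

definition heavy_hitters :: "nat \<Rightarrow> real \<Rightarrow> nat multiset \<Rightarrow> nat set" where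
  "heavy_hitters u \<phi> M = {x \<in> {1..u}. real (count M x) \<ge> \<phi> * real (size M)}"

definition approx_heavy_hitters :: "nat \<Rightarrow> real \<Rightarrow> real \<Rightarrow> nat multiset \<Rightarrow> nat set \<Rightarrow> bool" where
  "approx_heavy_hitters u \<epsilon> \<phi> M R \<longleftrightarrow>
     R \<subseteq> {1..u} \<and> heavy_hitters u \<phi> M \<subseteq> R \<and>
     (\<forall>x \<in> R. \<not> real (count M x) < (\<phi> - \<epsilon>) * real (size M))"

definition tracks_heavy_hitters ::
  "('s, 'c) protocol \<Rightarrow> nat \<Rightarrow> real \<Rightarrow> real \<Rightarrow> arrival list \<Rightarrow> bool" where
  "tracks_heavy_hitters P u \<epsilon> \<phi> A \<longleftrightarrow>
     (\<forall>t. \<exists>\<sigma> \<gamma> tr. execute P (arrived t A) = Some ((\<sigma>, \<gamma>), tr) \<and>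
        approx_heavy_hitters u \<epsilon> \<phi> (items (arrived t A)) (answer P \<gamma>))"

text \<open>
  Cost in words of \<open>w\<close> bits.  Every message costs at least one word, so that empty messages are
  not free.
\<close>

definition words :: "nat \<Rightarrow> message \<Rightarrow> nat" where
  "words w m = max 1 (nat \<lceil>real (length m) / real w\<rceil>)"

definition cost :: "nat \<Rightarrow> packet list \<Rightarrow> nat" where
  "cost w tr = (\<Sum>p\<leftarrow>tr. words w (payload p))"

text \<open>\<open>a = \<Theta>(b)\<close> with explicit constant \<open>c\<close>.\<close>

definition within_factor :: "real \<Rightarrow> real \<Rightarrow> real \<Rightarrow> bool" where
  "within_factor c a b \<longleftrightarrow> a \<le> c * b \<and> b \<le> c * a"

end

theory Submission
  imports Defs "HOL-Library.Nat_Bijection"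
begin

text \<open>
  No communication from the coordinator is needed.  A site that has received \<open>n\<^sub>j\<close> items reports the
  increment of a counter (one counter per item, and one for \<open>n\<^sub>j\<close> itself) as soon as the unreported
  part reaches \<open>\<delta> n\<^sub>j\<close>, where \<open>\<delta> = \<epsilon> / 2\<close>.  The errors of the sites add up to at most
  \<open>\<delta> \<Sum>\<^sub>j n\<^sub>j = \<delta> n\<close>.  Each report is paid for by \<open>\<delta> n\<^sub>j\<close> counter increments, and the \<open>i\<close>-th arrival at
  the site increments two counters, so it pays for at most \<open>2 / (\<delta> i)\<close> reports; summing the harmonic
  series over \<open>i\<close> and then over the sites gives \<open>O((k / \<epsilon>) log n)\<close> reports.
\<close>

subsection \<open>Binary encoding\<close>

text \<open>Least significant bit first, with top bit always 1: \<open>horner_sum of_bool 2\<close>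
  decodes it, and the length is logarithmic.\<close>

fun binary :: "nat \<Rightarrow> bool list" where
  "binary n = (if n = 0 then [] else odd n # binary (n div 2))"

declare binary.simps [simp del]

lemma horner_sum_binary [simp]: "horner_sum of_bool 2 (binary n) = n"
proof (induction n rule: binary.induct)
  case (1 n)
  then show ?case
    by (subst binary.simps) auto
qed

lemma two_power_length_binary: "n > 0 \<Longrightarrow> 2 ^ length (binary n) \<le> 2 * n"
proof (induction n rule: binary.induct)
  case (1 n)
  show ?case
  proof (cases "n div 2 = 0")
    case True
    then have "n = 1" using 1(2) by auto
    moreover have "binary 1 = [True]" by (simp add: binary.simps)
    ultimately show ?thesis by simp
  next
    case False
    then have "2 ^ length (binary (n div 2)) \<le> 2 * (n div 2)" using 1 by auto
    moreover have "2 ^ length (binary n) = 2 * (2 :: nat) ^ length (binary (n div 2))"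
      using 1(2) by (subst binary.simps) auto
    ultimately show ?thesis by linarith
  qed
qed

text \<open>Triangular numbers grow quadratically, so the Cantor code of the pair is at most
  \<open>(a + b + 1) ^ 2\<close>; hence the factor 2. A report thus costs logarithmically many bits
  although it carries two numbers.\<close>

lemma length_binary_prod_encode:
  "real (length (binary (prod_encode (a, b)))) \<le> 1 + 2 * log 2 (real (a + b + 1))"
proof (cases "prod_encode (a, b) = 0")
  case True
  then show ?thesis by (simp add: binary.simps)
next
  case False
  have "triangle m \<le> m * m" for m
    by (induction m) auto
  from this[of "a + b"] have "prod_encode (a, b) \<le> (a + b + 1) ^ 2"
    by (simp add: prod_encode_def power2_eq_square algebra_simps)
  with False two_power_length_binary[of "prod_encode (a, b)"]
  have "(2 :: nat) ^ length (binary (prod_encode (a, b))) \<le> 2 * (a + b + 1) ^ 2"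
    by (meson le_trans mult_le_mono2 neq0_conv)
  then have "real (2 ^ length (binary (prod_encode (a, b)))) \<le> real (2 * (a + b + 1) ^ 2)"
    by (rule of_nat_mono)
  then have "2 ^ length (binary (prod_encode (a, b))) \<le> 2 * real (a + b + 1) ^ 2"
    by simp
  then have "log 2 (2 ^ length (binary (prod_encode (a, b)))) \<le> log 2 (2 * real (a + b + 1) ^ 2)"
    by (subst log_le_cancel_iff) auto
  also have "\<dots> = 1 + 2 * log 2 (real (a + b + 1))"
    by (subst log_mult) (auto simp: log_nat_power)
  finally show ?thesis by (simp add: log_nat_power)
qed

subsection \<open>The reports of a single site\<close>

text \<open>
  Histories list the most recent item first.  Items are positive, which leaves counter \<open>0\<close> free for
  the length of the history.
\<close>

definition occ :: "nat list \<Rightarrow> nat \<Rightarrow> nat" where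
  "occ h y = (if y = 0 then length h else count_list h y)"

text \<open>What the coordinator has been told is a function of the site's history alone, so a site
  needs no memory beyond that history.\<close>

primrec reported :: "real \<Rightarrow> nat list \<Rightarrow> nat \<Rightarrow> nat" where
  "reported \<delta> [] = (\<lambda>y. 0)"
| "reported \<delta> (x # h) = (\<lambda>y.
     if y \<in> {0, x} \<and> \<delta> * real (length (x # h)) \<le> real (occ (x # h) y) - real (reported \<delta> h y)
     then occ (x # h) y else reported \<delta> h y)"

definition updates :: "real \<Rightarrow> nat \<Rightarrow> nat list \<Rightarrow> nat list" where
  "updates \<delta> x h = filter (\<lambda>y. reported \<delta> (x # h) y \<noteq> reported \<delta> h y) [0, x]"

declare reported.simps(2) [simp del]

lemma set_updates:
  "set (updates \<delta> x h) = {y \<in> {0, x}. reported \<delta> (x # h) y \<noteq> reported \<delta> h y}"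
  unfolding updates_def set_filter by auto

primrec num_updates :: "real \<Rightarrow> nat list \<Rightarrow> nat" where
  "num_updates \<delta> [] = 0"
| "num_updates \<delta> (x # h) = num_updates \<delta> h + length (updates \<delta> x h)"

lemma occ_Nil [simp]: "occ [] y = 0"
  by (simp add: occ_def)

lemma occ_Cons: "x > 0 \<Longrightarrow> occ (x # h) y = occ h y + of_bool (y \<in> {0, x})"
  by (auto simp: occ_def)

lemma occ_le_Cons: "occ h y \<le> occ (x # h) y"
  by (auto simp: occ_def)

lemma occ_le_length: "occ h y \<le> length h"
  by (simp add: occ_def count_le_length)

lemma reported_le_occ: "reported \<delta> h y \<le> occ h y"
proof (induction h)
  case (Cons x h)
  then show ?case using occ_le_Cons[of h y x] by (auto simp: reported.simps(2))
qed simp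

lemma reported_le_Cons: "reported \<delta> h y \<le> reported \<delta> (x # h) y"
  using reported_le_occ[of \<delta> h y] occ_le_Cons[of h y x] by (auto simp: reported.simps(2))

text \<open>Testing only the counters 0 and \<open>x\<close> suffices: any other counter keeps its
  error while its tolerance grows with the history.\<close>

lemma occ_le_reported:
  assumes "\<delta> \<ge> 0"
  shows "real (occ h y) \<le> real (reported \<delta> h y) + \<delta> * real (length h)"
proof (induction h)
  case (Cons x h)
  have "y \<notin> {0, x} \<Longrightarrow> occ (x # h) y = occ h y"
    by (auto simp: occ_def)
  moreover have "\<delta> * real (length h) \<le> \<delta> * real (length (x # h))"
    using assms by (simp add: mult_left_mono)
  moreover have "0 \<le> \<delta> * real (length (x # h))"
    using assms by simp
  ultimately show ?case using Cons by (auto simp: reported.simps(2) simp del: length_Cons)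
qed simp

section \<open>Amortized count of the reports of a site\<close>

definition pending :: "real \<Rightarrow> nat list \<Rightarrow> nat \<Rightarrow> real" where
  "pending \<delta> h y = (real (occ h y) - real (reported \<delta> h y)) / (\<delta> * real (length h))"

text \<open>\<open>pending\<close> is a potential: the unreported part in units of the current
  threshold. A longer history raises the threshold and so never raises the potential, an increment
  adds one over the threshold, and a report is sent only when the potential would reach 1. It then
  drops to 0, which pays for the report.\<close>

lemma pending_Cons:
  assumes "\<delta> > 0" "x > 0"
  shows "of_bool (y \<in> set (updates \<delta> x h)) + pending \<delta> (x # h) y
    \<le> pending \<delta> h y + of_bool (y \<in> {0, x}) / (\<delta> * real (length (x # h)))"
proof -
  define L where "L = \<delta> * real (length (x # h))"
  define a where "a = real (occ h y) - real (reported \<delta> h y)"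
  have L: "L > 0" using assms by (simp add: L_def)
  have a: "a \<ge> 0" using reported_le_occ[of \<delta> h y] by (simp add: a_def)
  \<comment> \<open>The threshold has only grown; for the empty history both numerators are
    0.\<close>
  have aL: "a / L \<le> pending \<delta> h y"
  proof (cases "h = []")
    case True
    then show ?thesis by (simp add: a_def pending_def)
  next
    case False
    then show ?thesis
      unfolding pending_def a_def[symmetric] L_def using a assms
      by (intro divide_left_mono mult_left_mono) auto
  qed
  show ?thesis
  proof (cases "y \<in> set (updates \<delta> x h)")
    case True
    then have y: "y \<in> {0, x}" and "reported \<delta> (x # h) y \<noteq> reported \<delta> h y"
      by (simp_all add: set_updates)
    then have due: "L \<le> real (occ (x # h) y) - real (reported \<delta> h y)"
      and "reported \<delta> (x # h) y = occ (x # h) y"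
      by (auto simp: L_def reported.simps(2) split: if_splits)
    then have "pending \<delta> (x # h) y = 0" by (simp add: pending_def)
    moreover have "occ (x # h) y = occ h y + 1"
      using y assms(2) by (simp only: occ_Cons of_bool_eq)
    with due have "L \<le> a + 1" by (simp add: a_def)
    then have "1 \<le> (a + 1) / L" using L by simp
    ultimately show ?thesis
      using True y aL unfolding L_def[symmetric] by (simp add: add_divide_distrib)
  next
    case False
    then have "y \<in> {0, x} \<Longrightarrow> reported \<delta> (x # h) y = reported \<delta> h y"
      by (simp add: set_updates)
    then have "reported \<delta> (x # h) y = reported \<delta> h y" by (auto simp: reported.simps(2))
    then have "pending \<delta> (x # h) y = (a + of_bool (y \<in> {0, x})) / L"
      unfolding pending_def L_def[symmetric] using assms(2) by (simp add: occ_Cons a_def)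
    then show ?thesis
      using False aL unfolding L_def[symmetric] by (simp add: add_divide_distrib)
  qed
qed

text \<open>Sum \<open>pending_Cons\<close> over all counters: the i-th arrival touches exactly two
  of them, 0 and a positive item, and so adds \<open>2 / (\<delta> * i)\<close>. The total is a
  harmonic sum.\<close>

lemma num_updates_pending:
  assumes "\<delta> > 0" "set h \<subseteq> {1..u}" "h \<noteq> []"
  shows "real (num_updates \<delta> h) + (\<Sum>y\<le>u. pending \<delta> h y) \<le> 2 / \<delta> * (1 + ln (real (length h)))"
  using assms(2,3)
proof (induction h)
  case (Cons x h)
  have x: "x > 0" "x \<le> u" using Cons.prems by auto
  have upd: "real (length (updates \<delta> x h)) = (\<Sum>y\<le>u. of_bool (y \<in> set (updates \<delta> x h)))"
  proof -
    have "distinct (updates \<delta> x h)" using x by (auto simp: updates_def)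
    moreover have "set (updates \<delta> x h) \<subseteq> {..u}" using x by (auto simp: set_updates)
    ultimately show ?thesis
      by (simp add: distinct_card Int_absorb1 flip: of_nat_sum)
  qed
  have two: "(\<Sum>y\<le>u. of_bool (y \<in> {0, x}) :: real) = 2"
  proof -
    have "{..u} \<inter> {0, x} = {0, x}" using x by auto
    moreover have "card {0, x} = 2" using x by simp
    ultimately show ?thesis by (simp del: insert_iff)
  qed
  have "real (length (updates \<delta> x h)) + (\<Sum>y\<le>u. pending \<delta> (x # h) y)
      = (\<Sum>y\<le>u. of_bool (y \<in> set (updates \<delta> x h)) + pending \<delta> (x # h) y)"
    by (simp only: upd sum.distrib)
  also have "\<dots> \<le> (\<Sum>y\<le>u. pending \<delta> h y + of_bool (y \<in> {0, x}) / (\<delta> * real (length (x # h))))"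
    by (intro sum_mono pending_Cons assms x)
  also have "\<dots> = (\<Sum>y\<le>u. pending \<delta> h y) + 2 / (\<delta> * real (length (x # h)))"
    by (simp only: sum.distrib two flip: sum_divide_distrib)
  finally have step: "real (num_updates \<delta> (x # h)) + (\<Sum>y\<le>u. pending \<delta> (x # h) y)
      \<le> real (num_updates \<delta> h) + (\<Sum>y\<le>u. pending \<delta> h y) + 2 / (\<delta> * real (length (x # h)))"
    by simp
  show ?case
  proof (cases "h = []")
    case True
    \<comment> \<open>The first arrival contributes \<open>2 / \<delta>\<close>, which is the 1 in
      the bound; the logarithm takes over from length one.\<close>
    then show ?thesis using step by (simp add: pending_def)
  next
    case False
    define m where "m = real (length h)"
    have m: "m > 0" using False by (simp add: m_def)
    \<comment> \<open>One term of the harmonic sum is at most the matching increment of the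
      logarithm.\<close>
    have "ln m - ln (m + 1) \<le> (m - (m + 1)) / (m + 1)"
      using m by (intro ln_diff_le) auto
    then have "1 / (m + 1) \<le> ln (m + 1) - ln m" by simp
    then have "2 / \<delta> * (1 / (m + 1)) \<le> 2 / \<delta> * (ln (m + 1) - ln m)"
      using assms(1) by (intro mult_left_mono) auto
    moreover have "real (num_updates \<delta> h) + (\<Sum>y\<le>u. pending \<delta> h y) \<le> 2 / \<delta> * (1 + ln m)"
      unfolding m_def using Cons False by auto
    moreover have m1: "real (length (x # h)) = m + 1" by (simp add: m_def)
    moreover have "2 / (\<delta> * real (length (x # h))) = 2 / \<delta> * (1 / (m + 1))"
      unfolding m1 by simp
    ultimately show ?thesis using step unfolding m1 ring_distribs by linarith
  qed
qed simp

lemma num_updates_le: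
  assumes "\<delta> > 0" "set h \<subseteq> {1..u}"
  shows "real (num_updates \<delta> h) \<le> 2 / \<delta> * (1 + ln (real (length h)))"
proof (cases "h = []")
  case False
  have "0 \<le> (\<Sum>y\<le>u. pending \<delta> h y)"
    using assms(1) reported_le_occ by (intro sum_nonneg) (simp add: pending_def)
  then show ?thesis using num_updates_pending[OF assms False] by linarith
qed (use assms in simp)

subsection \<open>The protocol\<close>

text \<open>Increments are sent rather than values, so the coordinator can add up all messages
  without keeping the sites apart.\<close>

definition site_reports :: "real \<Rightarrow> nat \<Rightarrow> nat list \<Rightarrow> message list" where
  "site_reports \<delta> x h =
     map (\<lambda>y. binary (prod_encode (y, reported \<delta> (x # h) y - reported \<delta> h y))) (updates \<delta> x h)"

definition estimate :: "nat \<Rightarrow> nat \<Rightarrow> nat" where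
  "estimate \<gamma> y =
     (\<Sum>p\<leftarrow>list_decode \<gamma>. let (z, d) = prod_decode p in if z = y then d else 0)"

text \<open>The coordinator's state codes the list of all numbers received. It does not know the
  number of items, so the threshold is relative to the estimate of counter 0. With
  \<open>\<delta> = \<epsilon> / 2\<close> the factor \<open>\<phi> - \<delta>\<close> lies midway
  between \<open>\<phi>\<close> and \<open>\<phi> - \<epsilon>\<close>.\<close>

definition one_way :: "nat \<Rightarrow> real \<Rightarrow> real \<Rightarrow> (nat, nat) protocol" where
  "one_way u \<delta> \<phi> = \<lparr>
     site_init = (\<lambda>j. list_encode []),
     coord_init = list_encode [],
     site_item = (\<lambda>j x s. (list_encode (x # list_decode s), site_reports \<delta> x (list_decode s))),
     site_recv = (\<lambda>i m s. (s, [])),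
     coord_recv = (\<lambda>j m \<gamma>. (list_encode (horner_sum of_bool 2 m # list_decode \<gamma>), [])),
     answer = (\<lambda>\<gamma>. {x \<in> {1..u}. (\<phi> - \<delta>) * real (estimate \<gamma> 0) \<le> real (estimate \<gamma> x)})\<rparr>"

lemma protocol_for_one_way: "protocol_for k (one_way u \<delta> \<phi>)"
  by (simp add: protocol_for_def one_way_def)

text \<open>The coordinator never replies, so the exchange ends after one delivery per message. The
  list is reversed because each number is put in front.\<close>

lemma exchange_one_way:
  "exchange (one_way u \<delta> \<phi>) (\<sigma>, \<gamma>) (map (To_Coord j) ms) =
     Some ((\<sigma>, list_encode (rev (map (horner_sum of_bool 2) ms) @ list_decode \<gamma>)), [],
       map (To_Coord j) ms)"
proof -
  let ?b = "\<lambda>(cfg, q, tr). q \<noteq> []"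
  let ?c = "\<lambda>(cfg, q, tr). let (cfg', out) = deliver (one_way u \<delta> \<phi>) (hd q) cfg
    in (cfg', tl q @ out, tr @ [hd q])"
  have "while_option ?b ?c ((\<sigma>, \<gamma>), map (To_Coord j) ms, tr) =
     Some ((\<sigma>, list_encode (rev (map (horner_sum of_bool 2) ms) @ list_decode \<gamma>)), [],
       tr @ map (To_Coord j) ms)" for tr
  proof (induction ms arbitrary: \<gamma> tr)
    case Nil
    then show ?case by (subst while_option_unfold) simp
  next
    case (Cons m ms)
    then show ?case by (subst while_option_unfold) (simp add: one_way_def)
  qed
  from this[of "[]"] show ?thesis by (simp add: exchange_def)
qed

section \<open>Executions of the protocol on a stream\<close>

definition hist :: "nat \<Rightarrow> arrival list \<Rightarrow> nat list" where
  "hist j A = rev (map (\<lambda>(t, i, x). x) (filter (\<lambda>(t, i, x). i = j) A))"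

lemma hist_Nil [simp]: "hist j [] = []"
  by (simp add: hist_def)

lemma hist_snoc: "hist j (A @ [(t, i, x)]) = (if i = j then x # hist j A else hist j A)"
  by (simp add: hist_def)

lemma length_hist_le: "length (hist j A) \<le> length A"
  by (simp add: hist_def)

text \<open>Since 0 and \<open>x\<close> differ, each counter gets at most one message per arrival.
  The truncated subtraction loses nothing because \<open>reported\<close> never decreases; the
  additive form keeps subtraction out of the statement.\<close>

lemma estimate_reports:
  assumes "x > 0"
  shows "estimate (list_encode
      (rev (map (horner_sum of_bool 2) (site_reports \<delta> x h)) @ list_decode \<gamma>)) y + reported \<delta> h y
    = estimate \<gamma> y + reported \<delta> (x # h) y"
proof -
  have "(\<Sum>p\<leftarrow>map (horner_sum of_bool 2) (site_reports \<delta> x h).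
      let (z, d) = prod_decode p in if z = y then d else 0)
      = reported \<delta> (x # h) y - reported \<delta> h y"
  proof (cases "y \<in> {0, x}")
    case True
    then show ?thesis using assms by (auto simp: site_reports_def updates_def)
  next
    case False
    then have "reported \<delta> (x # h) y = reported \<delta> h y" by (simp add: reported.simps(2))
    with False show ?thesis by (auto simp: site_reports_def updates_def)
  qed
  then show ?thesis
    using reported_le_Cons[of \<delta> h y x] by (simp add: estimate_def rev_map[symmetric])
qed

text \<open>The invariant of a run, by induction on the last arrival: it serves the accuracy proof
  through the estimates and the cost proof through the number and the contents of the
  messages.\<close>

lemma execute_one_way:
  assumes "\<forall>(t, j, x) \<in> set A. j \<in> {1..k} \<and> x \<in> {1..u}"
  shows "\<exists>\<gamma> tr. execute (one_way u \<delta> \<phi>) A = Some ((\<lambda>j. list_encode (hist j A), \<gamma>), tr) \<and>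
    (\<forall>y. estimate \<gamma> y = (\<Sum>j=1..k. reported \<delta> (hist j A) y)) \<and>
    length tr = (\<Sum>j=1..k. num_updates \<delta> (hist j A)) \<and>
    (\<forall>p \<in> set tr. \<exists>y d. y \<le> u \<and> d \<le> length A \<and> payload p = binary (prod_encode (y, d)))"
  using assms
proof (induction A rule: rev_induct)
  case Nil
  then show ?case
    by (simp add: execute_def one_way_def estimate_def)
next
  case (snoc a A)
  obtain t i x where a: "a = (t, i, x)" by (cases a)
  have i: "i \<in> {1..k}" and x: "x > 0" "x \<le> u" using snoc.prems by (auto simp: a)
  obtain \<gamma> tr where ex: "execute (one_way u \<delta> \<phi>) A = Some ((\<lambda>j. list_encode (hist j A), \<gamma>), tr)"
    and est: "\<And>y. estimate \<gamma> y = (\<Sum>j=1..k. reported \<delta> (hist j A) y)"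
    and len: "length tr = (\<Sum>j=1..k. num_updates \<delta> (hist j A))"
    and tr: "\<And>p. p \<in> set tr \<Longrightarrow>
      \<exists>y d. y \<le> u \<and> d \<le> length A \<and> payload p = binary (prod_encode (y, d))"
    using snoc by auto
  define ms where "ms = site_reports \<delta> x (hist i A)"
  define \<gamma>' where "\<gamma>' = list_encode (rev (map (horner_sum of_bool 2) ms) @ list_decode \<gamma>)"
  have "(\<lambda>j. list_encode (hist j A))(i := list_encode (x # hist i A))
      = (\<lambda>j. list_encode (hist j (A @ [a])))"
    by (auto simp: a hist_snoc)
  moreover have "site_item (one_way u \<delta> \<phi>) i x (list_encode (hist i A))
      = (list_encode (x # hist i A), ms)"
    by (simp add: one_way_def ms_def)
  ultimately have "execute (one_way u \<delta> \<phi>) (A @ [a]) =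
      Some ((\<lambda>j. list_encode (hist j (A @ [a])), \<gamma>'), tr @ map (To_Coord i) ms)"
    using ex by (simp add: execute_def a exchange_one_way \<gamma>'_def)
  moreover have "estimate \<gamma>' y = (\<Sum>j=1..k. reported \<delta> (hist j (A @ [a])) y)" for y
  proof -
    have "estimate \<gamma>' y + reported \<delta> (hist i A) y
        = (\<Sum>j=1..k. reported \<delta> (hist j A) y) + reported \<delta> (x # hist i A) y"
      using estimate_reports[OF x(1), of \<delta> "hist i A" \<gamma> y] est by (simp add: \<gamma>'_def ms_def)
    \<comment> \<open>Only site \<open>i\<close> changes, so its summand is split off and later put
      back.\<close>
    also have "(\<Sum>j=1..k. reported \<delta> (hist j A) y)
        = reported \<delta> (hist i A) y + (\<Sum>j\<in>{1..k} - {i}. reported \<delta> (hist j A) y)"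
      using i by (intro sum.remove) auto
    also have "(\<Sum>j\<in>{1..k} - {i}. reported \<delta> (hist j A) y)
        = (\<Sum>j\<in>{1..k} - {i}. reported \<delta> (hist j (A @ [a])) y)"
      by (intro sum.cong) (auto simp: a hist_snoc)
    finally have "estimate \<gamma>' y = reported \<delta> (hist i (A @ [a])) y
        + (\<Sum>j\<in>{1..k} - {i}. reported \<delta> (hist j (A @ [a])) y)"
      by (simp add: a hist_snoc)
    also have "\<dots> = (\<Sum>j=1..k. reported \<delta> (hist j (A @ [a])) y)"
      using i by (intro sum.remove[symmetric]) auto
    finally show ?thesis .
  qed
  moreover have "length (tr @ map (To_Coord i) ms)
      = (\<Sum>j=1..k. num_updates \<delta> (hist j (A @ [a])))"
  proof -
    have "(\<Sum>j=1..k. num_updates \<delta> (hist j (A @ [a])))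
        = (\<Sum>j=1..k. num_updates \<delta> (hist j A) + (if j = i then length ms else 0))"
      by (intro sum.cong) (auto simp: a hist_snoc ms_def site_reports_def)
    also have "\<dots> = length tr + length ms"
      using i len by (simp add: sum.distrib)
    finally show ?thesis by simp
  qed
  moreover have "\<exists>y d. y \<le> u \<and> d \<le> length (A @ [a]) \<and> payload p = binary (prod_encode (y, d))"
    if p: "p \<in> set (tr @ map (To_Coord i) ms)" for p
  proof (cases "p \<in> set tr")
    case True
    then obtain y d where "y \<le> u" "d \<le> length A" "payload p = binary (prod_encode (y, d))"
      using tr by blast
    then show ?thesis by (intro exI[of _ y] exI[of _ d]) simp
  next
    case False
    then obtain y where y: "y \<in> set (updates \<delta> x (hist i A))"
      and "payload p = binary (prod_encode (y, reported \<delta> (x # hist i A) y - reported \<delta> (hist i A) y))"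
      using p by (auto simp: ms_def site_reports_def)
    moreover have "y \<le> u" using y x by (auto simp: set_updates)
    \<comment> \<open>An increment is at most the new reported value, hence at most the number of
      arrivals.\<close>
    moreover have "reported \<delta> (x # hist i A) y \<le> length (A @ [a])"
      using reported_le_occ[of \<delta> "x # hist i A" y] occ_le_length[of "x # hist i A" y]
        length_hist_le[of i A] by (simp)
    ultimately show ?thesis
      by (meson diff_le_self le_trans)
  qed
  ultimately show ?case by blast
qed

section \<open>Accuracy of the answer\<close>

lemma size_items:
  assumes "\<forall>(t, j, x) \<in> set A. j \<in> {1..k} \<and> x \<in> {1..u}"
  shows "size (items A) = (\<Sum>j=1..k. length (hist j A))"
  using assms
proof (induction A rule: rev_induct)
  case (snoc a A)
  obtain t i x where a: "a = (t, i, x)" by (cases a)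
  have "(\<Sum>j=1..k. length (hist j (A @ [a])))
      = (\<Sum>j=1..k. length (hist j A) + (if j = i then 1 else 0))"
    by (intro sum.cong) (auto simp: a hist_snoc)
  also have "\<dots> = size (items A) + 1" using snoc by (simp add: sum.distrib a)
  finally show ?case by (simp add: items_def)
qed (simp add: items_def)

lemma count_items:
  assumes "\<forall>(t, j, x) \<in> set A. j \<in> {1..k} \<and> x \<in> {1..u}"
  shows "count (items A) y = (\<Sum>j=1..k. count_list (hist j A) y)"
  using assms
proof (induction A rule: rev_induct)
  case (snoc a A)
  obtain t i x where a: "a = (t, i, x)" by (cases a)
  have "(\<Sum>j=1..k. count_list (hist j (A @ [a])) y)
      = (\<Sum>j=1..k. count_list (hist j A) y + (if j = i then of_bool (x = y) else 0))"
    by (intro sum.cong) (auto simp: a hist_snoc)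
  also have "\<dots> = count (items A) y + of_bool (x = y)" using snoc by (simp add: sum.distrib a)
  finally show ?case by (simp add: items_def a)
qed (simp add: items_def)

text \<open>Every estimate, including \<open>n'\<close> for the stream length \<open>n\<close>, is
  too small by at most \<open>\<epsilon> / 2 * n\<close>. A heavy hitter therefore passes the test,
  as \<open>n'\<close> does not exceed \<open>n\<close>; an item that passes is frequent enough, as
  \<open>n'\<close> is at least \<open>(1 - \<epsilon> / 2) * n\<close>.\<close>

lemma approx_one_way:
  assumes A: "\<forall>(t, j, x) \<in> set A. j \<in> {1..k} \<and> x \<in> {1..u}"
    and "0 < \<epsilon>" "\<epsilon> \<le> \<phi>" "\<phi> \<le> 1"
    and est: "\<And>y. estimate \<gamma> y = (\<Sum>j=1..k. reported (\<epsilon> / 2) (hist j A) y)"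
  shows "approx_heavy_hitters u \<epsilon> \<phi> (items A) (answer (one_way u (\<epsilon> / 2) \<phi>) \<gamma>)"
proof -
  define n where "n = real (size (items A))"
  have est_le: "estimate \<gamma> y \<le> (\<Sum>j=1..k. occ (hist j A) y)" for y
    unfolding est by (intro sum_mono reported_le_occ)
  have "real (\<Sum>j=1..k. occ (hist j A) y)
      \<le> (\<Sum>j=1..k. real (reported (\<epsilon> / 2) (hist j A) y) + \<epsilon> / 2 * real (length (hist j A)))" for y
    unfolding of_nat_sum using assms(2) by (intro sum_mono occ_le_reported) auto
  then have est_ge: "real (\<Sum>j=1..k. occ (hist j A) y) \<le> real (estimate \<gamma> y) + \<epsilon> / 2 * n" for y
    by (simp add: est n_def size_items[OF A] sum.distrib sum_distrib_left)
  have occ0: "(\<Sum>j=1..k. occ (hist j A) 0) = size (items A)"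
    by (simp add: occ_def size_items[OF A])
  have occx: "(\<Sum>j=1..k. occ (hist j A) x) = count (items A) x" if "x \<noteq> 0" for x
    using that by (simp add: occ_def count_items[OF A])
  define n' where "n' = real (estimate \<gamma> 0)"
  have n': "n' \<le> n" "n \<le> n' + \<epsilon> / 2 * n"
    using est_le[of 0] est_ge[of 0] unfolding occ0 by (auto simp: n'_def n_def)
  have n0: "n \<ge> 0" by (simp add: n_def)
  have "(\<phi> - \<epsilon> / 2) * n' \<le> real (estimate \<gamma> x)"
    if "x \<noteq> 0" "\<phi> * n \<le> real (count (items A) x)" for x
  proof -
    have "(\<phi> - \<epsilon> / 2) * n' \<le> (\<phi> - \<epsilon> / 2) * n"
      using n' assms by (intro mult_left_mono) auto
    also have "\<dots> = \<phi> * n - \<epsilon> / 2 * n" by (simp add: algebra_simps)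
    finally show ?thesis
      using est_ge[of x] that unfolding occx[OF that(1)] by linarith
  qed
  moreover have "(\<phi> - \<epsilon>) * n \<le> real (count (items A) x)"
    if "x \<noteq> 0" "(\<phi> - \<epsilon> / 2) * n' \<le> real (estimate \<gamma> x)" for x
  proof -
    have "(\<phi> - \<epsilon> / 2) * (n - \<epsilon> / 2 * n) \<le> (\<phi> - \<epsilon> / 2) * n'"
      using n' assms by (intro mult_left_mono) auto
    \<comment> \<open>Here \<open>\<phi> \<le> 1\<close> enters: the loss from replacing
      \<open>n\<close> by \<open>n'\<close> fits into the remaining slack
      \<open>\<epsilon> / 2 * n\<close>.\<close>
    moreover have "(\<phi> - \<epsilon> / 2) * (\<epsilon> / 2 * n) \<le> 1 * (\<epsilon> / 2 * n)"
      using n0 assms by (intro mult_right_mono) auto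
    moreover have "real (estimate \<gamma> x) \<le> real (count (items A) x)"
      using est_le[of x] unfolding occx[OF that(1)] by simp
    moreover have "(\<phi> - \<epsilon> / 2) * (n - \<epsilon> / 2 * n)
        = (\<phi> - \<epsilon>) * n + \<epsilon> / 2 * n - (\<phi> - \<epsilon> / 2) * (\<epsilon> / 2 * n)"
      by (simp add: field_simps)
    ultimately show ?thesis using that(2) by linarith
  qed
  ultimately show ?thesis
    unfolding approx_heavy_hitters_def heavy_hitters_def n_def n'_def one_way_def
    by (auto simp: not_less)
qed

section \<open>Communication cost in words\<close>

lemma cost_le:
  assumes "\<And>p. p \<in> set tr \<Longrightarrow> real (words w (payload p)) \<le> K"
  shows "real (cost w tr) \<le> real (length tr) * K"
  using assms by (induction tr) (auto simp: cost_def algebra_simps intro: add_mono)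

text \<open>Both numbers in a message are polynomially bounded in \<open>n\<close>, as
  \<open>u\<close> is at most \<open>n powr c\<close>. So a message has O(log n) bits, while a word
  has at least \<open>l / c\<^sup>2\<close>.\<close>

lemma words_le:
  fixes c :: real
  assumes "c \<ge> 1" "n \<ge> 3" "y \<le> u" "d \<le> n"
    and un: "within_factor c (log 2 (real u)) (log 2 (real n))"
    and wu: "within_factor c (real w) (log 2 (real u))"
  shows "real (words w (binary (prod_encode (y, d)))) \<le> (2 * c + 5) * c\<^sup>2 + 1"
proof -
  define l where "l = log 2 (real n)"
  have l: "l \<ge> 1" using assms(2) by (simp add: l_def le_log_iff)
  have "l \<le> c * log 2 (real u)" "log 2 (real u) \<le> c * l" "log 2 (real u) \<le> c * real w"
    using un wu by (auto simp: within_factor_def l_def)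
  moreover from this have "c * log 2 (real u) \<le> c * (c * real w)"
    using assms(1) by (intro mult_left_mono) auto
  ultimately have lw: "l \<le> c\<^sup>2 * real w" by (simp add: power2_eq_square)
  \<comment> \<open>For \<open>u = 0\<close> the default \<open>log 2 0 = 0\<close> would contradict
    \<open>l \<ge> 1\<close>.\<close>
  have u0: "u > 0"
    using \<open>l \<le> c * log 2 (real u)\<close> l by (cases "u = 0") (auto simp: log_def)
  have u: "real u \<le> real n powr c"
  proof -
    have "real u = 2 powr log 2 (real u)" using u0 by simp
    also have "\<dots> \<le> 2 powr (c * l)" using \<open>log 2 (real u) \<le> c * l\<close> by simp
    also have "\<dots> = real n powr c" using assms(2) by (simp add: l_def mult.commute[of c] flip: powr_powr)
    finally show ?thesis .
  qed
  have n: "real n \<le> real n powr c"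
    using powr_mono[of 1 c "real n"] assms(1,2) by simp
  \<comment> \<open>Each of the three summands is at most \<open>n powr c\<close>; then
    \<open>n \<ge> 3\<close> absorbs the factor 3 into the exponent.\<close>
  have "real (y + d + 1) \<le> 3 * real n powr c"
    using u n assms(2-4) by linarith
  also have "\<dots> \<le> real n * real n powr c"
    using assms(2) by (intro mult_right_mono) auto
  also have "\<dots> = real n powr (c + 1)" using assms(2) by (simp add: powr_add)
  finally have "log 2 (real (y + d + 1)) \<le> log 2 (real n powr (c + 1))"
    using assms(2) by (subst log_le_cancel_iff) auto
  then have "log 2 (real (y + d + 1)) \<le> (c + 1) * l" by (simp add: l_def log_powr)
  with length_binary_prod_encode[of y d]
  have "real (length (binary (prod_encode (y, d)))) \<le> 1 + 2 * ((c + 1) * l)" by linarith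
  also have "\<dots> \<le> (2 * c + 5) * l" using l by (simp add: algebra_simps)
  also have "\<dots> \<le> (2 * c + 5) * (c\<^sup>2 * real w)" using lw assms(1) by (intro mult_left_mono) auto
  finally have len: "real (length (binary (prod_encode (y, d)))) \<le> (2 * c + 5) * c\<^sup>2 * real w"
    by (simp add: mult.assoc)
  have "w > 0" using lw l by (cases "w = 0") auto
  with len have "real (length (binary (prod_encode (y, d)))) / real w \<le> (2 * c + 5) * c\<^sup>2"
    by (simp add: divide_le_eq)
  moreover have "0 \<le> (2 * c + 5) * c\<^sup>2" using assms(1) by simp
  \<comment> \<open>The final 1 in the bound pays for rounding up and for the minimum charge of one
    word.\<close>
  ultimately show ?thesis unfolding words_def by linarith
qed

theorem theorem1:
  fixes c :: real
  assumes "c \<ge> 1"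
  shows "\<exists>(C :: real) (N :: nat \<Rightarrow> real \<Rightarrow> nat).
    \<forall>(k :: nat) (\<epsilon> :: real) (\<phi> :: real) (u :: nat).
      k \<ge> 2 \<and> 0 < \<epsilon> \<and> \<epsilon> \<le> \<phi> \<and> \<phi> \<le> 1 \<and> u \<ge> 1 \<longrightarrow>
      (\<exists>P :: (nat, nat) protocol. protocol_for k P \<and>
        (\<forall>A. stream k u A \<longrightarrow>
          tracks_heavy_hitters P u \<epsilon> \<phi> A \<and>
          (\<forall>w. length A \<ge> N k \<epsilon> \<and>
               within_factor c (log 2 (real u)) (log 2 (real (length A))) \<and>
               within_factor c (real w) (log 2 (real u)) \<longrightarrow>
            (\<exists>cfg tr. execute P A = Some (cfg, tr) \<and>
               real (cost w tr) \<le> C * (real k / \<epsilon>) * ln (real (length A))))))"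
proof -
  define K where "K = (2 * c + 5) * c\<^sup>2 + 1"
  have K: "K \<ge> 0" using assms by (simp add: K_def)
  have main: "tracks_heavy_hitters (one_way u (\<epsilon> / 2) \<phi>) u \<epsilon> \<phi> A"
    "\<And>w. \<lbrakk>length A \<ge> 3; within_factor c (log 2 (real u)) (log 2 (real (length A)));
       within_factor c (real w) (log 2 (real u))\<rbrakk> \<Longrightarrow>
       \<exists>cfg tr. execute (one_way u (\<epsilon> / 2) \<phi>) A = Some (cfg, tr) \<and>
         real (cost w tr) \<le> 8 * K * (real k / \<epsilon>) * ln (real (length A))"
    if eps: "0 < \<epsilon>" "\<epsilon> \<le> \<phi>" "\<phi> \<le> 1" and "stream k u A" for k u :: nat and \<epsilon> \<phi> :: real and A
  proof -
    have A: "\<forall>(t, j, x) \<in> set A. j \<in> {1..k} \<and> x \<in> {1..u}"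
      using that by (simp add: stream_def)
    show "tracks_heavy_hitters (one_way u (\<epsilon> / 2) \<phi>) u \<epsilon> \<phi> A"
      unfolding tracks_heavy_hitters_def
    proof
      fix t
      have "\<forall>(t, j, x) \<in> set (arrived t A). j \<in> {1..k} \<and> x \<in> {1..u}"
        using A by (auto simp: arrived_def)
      from execute_one_way[OF this, of "\<epsilon> / 2" \<phi>] approx_one_way[OF this eps]
      show "\<exists>\<sigma> \<gamma> tr. execute (one_way u (\<epsilon> / 2) \<phi>) (arrived t A) = Some ((\<sigma>, \<gamma>), tr) \<and>
          approx_heavy_hitters u \<epsilon> \<phi> (items (arrived t A)) (answer (one_way u (\<epsilon> / 2) \<phi>) \<gamma>)"
        by blast
    qed
    fix w
    assume n: "length A \<ge> 3" and within: "within_factor c (log 2 (real u)) (log 2 (real (length A)))"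
      "within_factor c (real w) (log 2 (real u))"
    define l where "l = ln (real (length A))"
    \<comment> \<open>Three exceeds e; this lets \<open>1 + ln\<close> be bounded by
      \<open>2 * l\<close> below.\<close>
    have l: "l \<ge> 1"
      using n exp_le by (subst l_def, subst ln_ge_iff) linarith+
    obtain \<gamma> tr where
      ex: "execute (one_way u (\<epsilon> / 2) \<phi>) A = Some ((\<lambda>j. list_encode (hist j A), \<gamma>), tr)"
      and len: "length tr = (\<Sum>j=1..k. num_updates (\<epsilon> / 2) (hist j A))"
      and tr: "\<And>p. p \<in> set tr \<Longrightarrow>
        \<exists>y d. y \<le> u \<and> d \<le> length A \<and> payload p = binary (prod_encode (y, d))"
      using execute_one_way[OF A, of "\<epsilon> / 2" \<phi>] by blast
    \<comment> \<open>The 8 is \<open>2 / (\<epsilon> / 2) = 4 / \<epsilon>\<close>, doubled to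
      absorb the 1 next to the logarithm.\<close>
    have "real (num_updates (\<epsilon> / 2) (hist j A)) \<le> 8 / \<epsilon> * l" for j
    proof -
      have "set (hist j A) \<subseteq> {1..u}" using A by (auto simp: hist_def)
      then have "real (num_updates (\<epsilon> / 2) (hist j A)) \<le> 4 / \<epsilon> * (1 + ln (real (length (hist j A))))"
        using num_updates_le[of "\<epsilon> / 2"] eps by force
      also have "\<dots> \<le> 4 / \<epsilon> * (2 * l)"
      proof (intro mult_left_mono)
        have "ln (real (length (hist j A))) \<le> l"
          using length_hist_le[of j A] l
          by (cases "hist j A = []") (auto simp: l_def intro!: ln_mono)
        then show "1 + ln (real (length (hist j A))) \<le> 2 * l" using l by simp
      qed (use eps in simp)
      finally show ?thesis by simp
    qed
    then have "real (length tr) \<le> (\<Sum>j=1..k. 8 / \<epsilon> * l)"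
      unfolding len of_nat_sum by (intro sum_mono)
    then have "real (length tr) * K \<le> real k * (8 / \<epsilon> * l) * K"
      using K by (intro mult_right_mono) auto
    moreover have "real (words w (payload p)) \<le> K" if "p \<in> set tr" for p
      using tr[OF that] words_le[OF assms n _ _ within] by (auto simp: K_def)
    then have "real (cost w tr) \<le> real (length tr) * K" by (rule cost_le)
    ultimately have "real (cost w tr) \<le> 8 * K * (real k / \<epsilon>) * ln (real (length A))"
      by (simp add: l_def mult_ac)
    with ex show "\<exists>cfg tr. execute (one_way u (\<epsilon> / 2) \<phi>) A = Some (cfg, tr) \<and>
        real (cost w tr) \<le> 8 * K * (real k / \<epsilon>) * ln (real (length A))" by blast
  qed
  \<comment> \<open>\<open>K\<close> depends on \<open>c\<close> alone, so \<open>8 * K\<close> is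
    uniform in all other parameters, and length 3 is already sufficiently large.\<close>
  show ?thesis
    by (rule exI[of _ "8 * K"], rule exI[of _ "\<lambda>_ _. 3"])
      (use main protocol_for_one_way in blast)
qed

end
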